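(* There is a constant $c(n)$ depending only on $n$ such that the following holds. Let $\mathscr{D}$ be a general dyadic grid in $\mathbb{R}^n$, $\mathcal{S}_1\subset\mathscr{D}$ a finite sparse family, $i\in\mathbb{N}$ ($i\ge1$), and $f\ge0$ a locally integrable function. Then there is a sparse family $\mathcal{S}_2\subset\mathscr{D}$ such that for a.e. $x\in\mathbb{R}^n$, $$\mathcal{A}_{\mathcal{S}_1,i}^{\star}f(x)\le c(n)\,i\,\big(Mf(x)+\mathcal{A}_{\mathcal{S}_2}f(x)\big).$$
   Context: $M$ is the Hardy–Littlewood maximal operator, and $f_Q=\frac1{|Q|}\int_Qf$. General dyadic grid $\mathscr{D}$: a collection of cubes in $\mathbb{R}^n$ such that (i) every $Q\in\mathscr{D}$ has sidelength $\ell_Q=2^k$ for some $k\in\mathbb{Z}$; (ii) $Q\cap R\in\{Q,R,\emptyset\}$ for all $Q,R\in\mathscr{D}$; (iii) the cubes of each fixed sidelength $2^k$ form a partition of $\mathbb{R}^n$. For $Q\in\mathscr{D}$, the $i$-th ancestor $Q^{(i)}$ is the unique cube of $\mathscr{D}$ containing $Q$ with $\ell_{Q^{(i)}}=2^i\ell_Q$. Sparse family $\mathcal{S}=\{Q_j^k\}\subset\mathscr{D}$ (possibly empty; the level $k$ runs over a finite or infinite interval of consecutive integers): (i) for fixed $k$ the cubes $Q_j^k$ are pairwise disjoint in $j$; (ii) with $\Omega_k=\bigcup_jQ_j^k$, $\Omega_{k+1}\subset\Omega_k$; (iii) $|\Omega_{k+1}\cap Q_j^k|\le\frac12|Q_j^k|$.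 For a sparse family $\mathcal{S}=\{Q_j^k\}$: $$\mathcal{A}_{\mathcal{S}}f(x)=\sum_{j,k}f_{Q_j^k}\chi_{Q_j^k}(x),\qquad \mathcal{A}_{\mathcal{S},i}^{\star}f(x)=\frac1{2^{in}}\sum_{k,j}f_{Q_j^k}\chi_{(Q_j^k)^{(i)}}(x).$$ *)

theory Defs
  imports "HOL-Analysis.Analysis"
begin

text \<open>
  Cubes have sides parallel to the axes. Each of the intervals whose product is the cube may
  contain any subset of its endpoints; the sets between \<open>{a<..<b}\<close> and \<open>{a..b}\<close> are exactly the
  intervals with endpoints \<open>a\<close> and \<open>b\<close>.
\<close>
definition cube_of_side :: "real \<Rightarrow> (real^'n) set \<Rightarrow> bool" where
  "cube_of_side l Q \<longleftrightarrow> l > 0 \<and>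
     (\<exists>(a :: real^'n) (I :: 'n \<Rightarrow> real set).
        (\<forall>j. {a $ j <..< a $ j + l} \<subseteq> I j \<and> I j \<subseteq> {a $ j .. a $ j + l}) \<and>
        Q = {x. \<forall>j. x $ j \<in> I j})"

definition cube :: "(real^'n) set \<Rightarrow> bool" where
  "cube Q \<longleftrightarrow> (\<exists>l. cube_of_side l Q)"

definition side_length :: "(real^'n) set \<Rightarrow> real" where
  "side_length Q = (THE l. cube_of_side l Q)"

definition dyadic_grid :: "(real^'n) set set \<Rightarrow> bool" where
  "dyadic_grid \<D> \<longleftrightarrow>
     (\<forall>Q\<in>\<D>. cube Q \<and> (\<exists>k::int. side_length Q = 2 powi k)) \<and>
     (\<forall>Q\<in>\<D>. \<forall>R\<in>\<D>. Q \<inter> R \<in> {Q, R, {}}) \<and>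
     (\<forall>k::int. partition_on UNIV {Q \<in> \<D>. side_length Q = 2 powi k})"

definition ancestor :: "(real^'n) set set \<Rightarrow> nat \<Rightarrow> (real^'n) set \<Rightarrow> (real^'n) set" where
  "ancestor \<D> i Q = (THE R. R \<in> \<D> \<and> Q \<subseteq> R \<and> side_length R = 2 ^ i * side_length Q)"

text \<open>
  A family of cubes \<open>Q\<^sub>j\<^sup>k\<close> is represented by the set of pairs \<open>(k, Q\<^sub>j\<^sup>k)\<close>. The index \<open>j\<close> is not
  needed, since nonempty cubes that are disjoint for different \<open>j\<close> are distinct.
\<close>
type_synonym 'n cube_family = "(int \<times> (real^'n) set) set"

definition level_union :: "'n::finite cube_family \<Rightarrow> int \<Rightarrow> (real^'n) set" where
  "level_union S k = \<Union> (S `` {k})"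

text \<open>
  \<open>K\<close> is the interval of consecutive integers over which the level runs. For a last level \<open>k\<close> the
  union at level \<open>k + 1\<close> is empty, and the half-measure condition is vacuous.
\<close>
definition sparse_family :: "(real^'n) set set \<Rightarrow> 'n::finite cube_family \<Rightarrow> bool" where
  "sparse_family \<D> S \<longleftrightarrow>
     (\<exists>K :: int set.
        (\<forall>a\<in>K. \<forall>b\<in>K. {a..b} \<subseteq> K) \<and>
        S \<subseteq> K \<times> \<D> \<and>
        (\<forall>k\<in>K. disjoint (S `` {k})) \<and>
        (\<forall>k. k \<in> K \<and> k + 1 \<in> K \<longrightarrow> level_union S (k + 1) \<subseteq> level_union S k) \<and>
        (\<forall>(k, Q)\<in>S. measure lebesgue (level_union S (k + 1) \<inter> Q) \<le> 1 / 2 * measure lebesgue Q))"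

definition locally_integrable :: "(real^'n \<Rightarrow> real) \<Rightarrow> bool" where
  "locally_integrable f \<longleftrightarrow> (\<forall>C. compact C \<longrightarrow> set_integrable lebesgue C f)"

definition mean :: "(real^'n \<Rightarrow> real) \<Rightarrow> (real^'n) set \<Rightarrow> real" where
  "mean f Q = 1 / measure lebesgue Q * (LINT y:Q|lebesgue. f y)"

text \<open>
  The operators below may be infinite at a point, so they take values in \<^typ>\<open>ennreal\<close>. The two
  sparse operators are meant for \<open>f \<ge> 0\<close>, where \<^const>\<open>ennreal\<close> does not truncate the means.
\<close>
definition maximal_function :: "(real^'n \<Rightarrow> real) \<Rightarrow> real^'n \<Rightarrow> ennreal" where
  "maximal_function f x = (SUP Q\<in>{Q. cube Q \<and> x \<in> Q}. ennreal (mean (\<lambda>y. \<bar>f y\<bar>) Q))"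

definition sparse_op :: "'n::finite cube_family \<Rightarrow> (real^'n \<Rightarrow> real) \<Rightarrow> real^'n \<Rightarrow> ennreal" where
  "sparse_op S f x = (\<Sum>\<^sub>\<infinity>(k, Q)\<in>S. ennreal (mean f Q) * indicator Q x)"

definition sparse_op_star ::
  "(real^'n) set set \<Rightarrow> 'n::finite cube_family \<Rightarrow> nat \<Rightarrow> (real^'n \<Rightarrow> real) \<Rightarrow> real^'n \<Rightarrow> ennreal" where
  "sparse_op_star \<D> S i f x =
     ennreal (1 / 2 ^ (i * CARD('n))) *
       (\<Sum>\<^sub>\<infinity>(k, Q)\<in>S. ennreal (mean f Q) * indicator (ancestor \<D> i Q) x)"

end

theory Submission
  imports Defs
begin

text \<open>
  For \<open>R \<in> \<D>\<close> consider the localized sum \<open>\<Sum> f\<^sub>Q 2\<^sup>-\<^sup>i\<^sup>n \<chi>\<close> over the \<open>Q \<in> S\<^sub>1\<close> whose \<open>i\<close>-th ancestor lies in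
  \<open>R\<close>; note that \<open>2\<^sup>-\<^sup>i\<^sup>n f\<^sub>Q\<close> is the integral of \<open>f\<close> over \<open>Q\<close> divided by the measure of the ancestor.
  Stop at the maximal ancestors \<open>P \<subseteq> R\<close> at which the partial sum over the ancestors between \<open>P\<close> and
  \<open>R\<close> exceeds \<open>36 i f\<^sub>R\<close>. A weak-type estimate, linear in \<open>i\<close> and obtained from an \<open>L\<^sup>1\<close> bound off the
  cubes with large mean, shows that these \<open>P\<close> cover at most half of \<open>R\<close>. On \<open>R\<close> the localized sum is
  at most \<open>36 i f\<^sub>R\<close> plus the localized sums of the stopping cubes. Iterating from the maximal
  ancestors, the generations of stopping cubes form \<open>S\<^sub>2\<close>.
\<close>

section \<open>Stopping cubes in an abstract nested system of sets\<close>

definition maximals :: "'a set set \<Rightarrow> 'a set set" where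
  "maximals F = {P \<in> F. \<forall>R\<in>F. P \<subseteq> R \<longrightarrow> P = R}"

lemma maximals_subset: "maximals F \<subseteq> F"
  by (auto simp: maximals_def)

lemma ex_maximals_superset:
  assumes "finite F" "P \<in> F"
  obtains R where "R \<in> maximals F" "P \<subseteq> R"
  using finite_has_maximal2[OF assms] by (auto simp: maximals_def)

text \<open>This isolates the finite combinatorics from integration: \<open>\<mu>\<close> stands for
  Lebesgue measure, \<open>\<nu>\<close> for the integral of \<open>f\<close>, and \<open>A\<close>
  for the \<open>i\<close>-th ancestor. Sparseness enters only as the packing bound
  \<open>carleson\<close>. The factor \<open>i\<close> in \<open>escaping\<close> counts the
  possible sizes of a cube inside \<open>B\<close> whose ancestor sticks out of
  \<open>B\<close>.\<close>

locale nested_packing =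
  fixes \<D> :: "'a set set" and S :: "'a set set" and A :: "'a set \<Rightarrow> 'a set"
    and \<mu> \<nu> :: "'a set \<Rightarrow> real" and i :: nat
  assumes nested: "\<And>Q R. Q \<in> \<D> \<Longrightarrow> R \<in> \<D> \<Longrightarrow> Q \<inter> R \<in> {Q, R, {}}"
    and nonempty: "\<And>Q. Q \<in> \<D> \<Longrightarrow> Q \<noteq> {}"
    and \<mu>_pos: "\<And>Q. Q \<in> \<D> \<Longrightarrow> \<mu> Q > 0"
    and \<nu>_nonneg: "\<And>Q. Q \<in> \<D> \<Longrightarrow> \<nu> Q \<ge> 0"
    and \<mu>_sum_le: "\<And>F R. finite F \<Longrightarrow> F \<subseteq> \<D> \<Longrightarrow> disjoint F \<Longrightarrow> R \<in> \<D> \<Longrightarrow> \<Union>F \<subseteq> R \<Longrightarrow> sum \<mu> F \<le> \<mu> R"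
    and \<nu>_sum_le: "\<And>F R. finite F \<Longrightarrow> F \<subseteq> \<D> \<Longrightarrow> disjoint F \<Longrightarrow> R \<in> \<D> \<Longrightarrow> \<Union>F \<subseteq> R \<Longrightarrow> sum \<nu> F \<le> \<nu> R"
    and finite_S: "finite S"
    and S_subset: "S \<subseteq> \<D>"
    and A_in: "\<And>Q. Q \<in> S \<Longrightarrow> A Q \<in> \<D>"
    and A_superset: "\<And>Q. Q \<in> S \<Longrightarrow> Q \<subseteq> A Q"
    and carleson: "\<And>R. R \<in> \<D> \<Longrightarrow> sum \<mu> {Q \<in> S. Q \<subseteq> R} \<le> 2 * \<mu> R"
    and escaping: "\<And>B. B \<in> \<D> \<Longrightarrow> sum \<nu> {Q \<in> S. Q \<subseteq> B \<and> \<not> A Q \<subseteq> B} \<le> real i * \<nu> B"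
    and i_pos: "i \<ge> 1"
begin

lemma disjoint_maximals:
  assumes "F \<subseteq> \<D>"
  shows "disjoint (maximals F)"
  unfolding pairwise_def disjnt_def
proof (intro ballI impI)
  fix Q R assume *: "Q \<in> maximals F" "R \<in> maximals F" "Q \<noteq> R"
  then have "\<not> Q \<subseteq> R" "\<not> R \<subseteq> Q" by (auto simp: maximals_def)
  moreover have "Q \<inter> R \<in> {Q, R, {}}"
    using * assms maximals_subset by (intro nested) blast+
  ultimately show "Q \<inter> R = {}" by fast
qed

definition weight :: "'a set \<Rightarrow> real" where
  "weight Q = \<nu> Q / \<mu> (A Q)"

definition truncated :: "'a set \<Rightarrow> 'a \<Rightarrow> real" where
  "truncated R x = sum weight {Q \<in> S. A Q \<subseteq> R \<and> x \<in> A Q}"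

text \<open>This is the part of \<open>truncated R\<close> coming from ancestors that contain
  \<open>P\<close>. It is constant on \<open>P\<close>, so the stopping rule can select whole cubes
  instead of points.\<close>

definition between :: "'a set \<Rightarrow> 'a set \<Rightarrow> real" where
  "between P R = sum weight {Q \<in> S. P \<subseteq> A Q \<and> A Q \<subseteq> R}"

text \<open>Candidates are ancestors of cubes of \<open>S\<close>, hence finite in number, and
  maximality makes the selected ones disjoint. The strict inequality leaves no candidate when
  \<open>\<nu> R = 0\<close>.\<close>

definition stopping :: "'a set \<Rightarrow> 'a set set" where
  "stopping R = maximals {P \<in> A ` S. P \<subseteq> R \<and> between P R > 36 * i * (\<nu> R / \<mu> R)}"

lemma stopping_subset: "stopping R \<subseteq> A ` S" and stopping_le: "P \<in> stopping R \<Longrightarrow> P \<subseteq> R"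
  and stopping_gt: "P \<in> stopping R \<Longrightarrow> between P R > 36 * i * (\<nu> R / \<mu> R)"
  using maximals_subset unfolding stopping_def by blast+

lemma A_image_subset: "A ` S \<subseteq> \<D>"
  using A_in by auto

lemma stopping_in_grid: "P \<in> stopping R \<Longrightarrow> P \<in> \<D>"
  using stopping_subset A_image_subset by blast

lemma finite_stopping: "finite (stopping R)"
  using stopping_subset finite_S by (meson finite_imageI finite_subset)

lemma disjoint_stopping: "disjoint (stopping R)"
  unfolding stopping_def by (rule disjoint_maximals) (use A_image_subset in auto)

lemma weight_nonneg: "Q \<in> S \<Longrightarrow> weight Q \<ge> 0"
  unfolding weight_def by (meson A_in S_subset \<mu>_pos \<nu>_nonneg divide_nonneg_pos subsetD)

lemma \<nu>_mono: "Q \<in> \<D> \<Longrightarrow> R \<in> \<D> \<Longrightarrow> Q \<subseteq> R \<Longrightarrow> \<nu> Q \<le> \<nu> R"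
  using \<nu>_sum_le[of "{Q}" R] by simp

text \<open>
  The cubes of \<open>S\<close> with mean above four times that of \<open>R\<close> cover at most a quarter of \<open>R\<close>. Off
  them an \<open>L\<^sup>1\<close> bound suffices: a cube outside them has bounded mean, so these are handled by
  the packing condition, and a cube \<open>Q\<close> inside one of them contributes only while \<open>A Q\<close> sticks out.
\<close>
lemma sum_stopping_le:
  assumes R: "R \<in> \<D>"
  shows "sum \<mu> (stopping R) \<le> 1 / 2 * \<mu> R"
proof (cases "\<nu> R = 0")
  case True
  have "between P R = 0" for P
    unfolding between_def
  proof (intro sum.neutral ballI)
    fix Q assume "Q \<in> {Q \<in> S. P \<subseteq> A Q \<and> A Q \<subseteq> R}"
    then have "Q \<in> \<D>" "Q \<subseteq> R" using S_subset A_superset by blast+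
    then have "\<nu> Q = 0" using \<nu>_mono[of Q R] \<nu>_nonneg[of Q] R True by simp
    then show "weight Q = 0" by (simp add: weight_def)
  qed
  then have "stopping R = {}" using stopping_gt[of _ R] True by fastforce
  then show ?thesis using \<mu>_pos[OF R] by simp
next
  case False
  define a where "a = \<nu> R / \<mu> R"
  have a: "a > 0" and aR: "a * \<mu> R = \<nu> R"
    using False \<mu>_pos[OF R] \<nu>_nonneg[OF R] by (simp_all add: a_def)
  define F where "F = {Q \<in> S. Q \<subseteq> R \<and> \<nu> Q > 4 * a * \<mu> Q}"
  define \<B> where "\<B> = maximals F"
  have F: "finite F" "F \<subseteq> \<D>" using finite_S S_subset by (auto simp: F_def)
  have BF: "\<B> \<subseteq> F" unfolding \<B>_def by (rule maximals_subset)
  have B: "finite \<B>" "\<B> \<subseteq> \<D>" "disjoint \<B>" "\<Union>\<B> \<subseteq> R"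
    using BF F finite_subset disjoint_maximals[of F] by (auto simp: \<B>_def F_def)
  have \<nu>B: "sum \<nu> \<B> \<le> \<nu> R" using \<nu>_sum_le B R by blast
  have "4 * a * sum \<mu> \<B> \<le> sum \<nu> \<B>"
    unfolding sum_distrib_left using BF by (intro sum_mono) (auto simp: F_def)
  then have "a * (4 * sum \<mu> \<B>) \<le> a * \<mu> R" using \<nu>B aR by simp
  then have \<mu>B: "sum \<mu> \<B> \<le> 1 / 4 * \<mu> R" using a by simp
  \<comment> \<open>The stopping cubes in \<open>C\<close> lie inside cubes of large mean and are
    controlled by the measure of the latter; those in \<open>C'\<close> are controlled by the
    \<open>L^1\<close> bound.\<close>
  define C where "C = {P \<in> stopping R. \<exists>b\<in>\<B>. P \<subseteq> b}"
  define C' where "C' = stopping R - C"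
  have st: "finite (stopping R)" "stopping R \<subseteq> \<D>" "disjoint (stopping R)"
    using finite_stopping stopping_subset A_image_subset disjoint_stopping by blast+
  have packed: "sum \<mu> {P \<in> E. P \<subseteq> b} \<le> \<mu> b" if "E \<subseteq> stopping R" "b \<in> \<D>" for b E
  proof (rule \<mu>_sum_le)
    show "disjoint {P \<in> E. P \<subseteq> b}" using st(3) that(1) by (auto simp: pairwise_def)
    show "finite {P \<in> E. P \<subseteq> b}" using st(1) that(1) by (auto intro: finite_subset)
  qed (use that st in auto)
  have "sum \<mu> C = sum \<mu> (\<Union>b\<in>\<B>. {P \<in> C. P \<subseteq> b})"
    by (rule sum.cong) (auto simp: C_def)
  also have "\<dots> = (\<Sum>b\<in>\<B>. sum \<mu> {P \<in> C. P \<subseteq> b})"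
  proof (rule sum.UNION_disjoint)
    show "\<forall>b\<in>\<B>. \<forall>b'\<in>\<B>. b \<noteq> b' \<longrightarrow> {P \<in> C. P \<subseteq> b} \<inter> {P \<in> C. P \<subseteq> b'} = {}"
    proof (intro ballI impI equals0I)
      fix b b' P assume *: "b \<in> \<B>" "b' \<in> \<B>" "b \<noteq> b'" "P \<in> {P \<in> C. P \<subseteq> b} \<inter> {P \<in> C. P \<subseteq> b'}"
      then have "P \<noteq> {}" using st nonempty by (auto simp: C_def)
      moreover have "b \<inter> b' = {}" using B(3) * by (auto simp: pairwise_def disjnt_def)
      ultimately show False using * by blast
    qed
  qed (use B st in \<open>auto simp: C_def\<close>)
  also have "\<dots> \<le> sum \<mu> \<B>"
    using B by (intro sum_mono packed) (auto simp: C_def)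
  finally have C: "sum \<mu> C \<le> 1 / 4 * \<mu> R" using \<mu>B by simp
  define SR where "SR = {Q \<in> S. A Q \<subseteq> R}"
  define U where "U = {Q \<in> SR. \<not> (\<exists>b\<in>\<B>. A Q \<subseteq> b)}"
  have fin: "finite SR" "finite U" "finite C'" using finite_S st by (auto simp: SR_def U_def C'_def)
  \<comment> \<open>Chebyshev's inequality: on each \<open>P\<close> in \<open>C'\<close> the
    partial sum is at least the threshold. The resulting double sum is then rearranged according to
    \<open>Q\<close>.\<close>
  have "36 * i * a * sum \<mu> C' \<le> (\<Sum>P\<in>C'. \<mu> P * between P R)"
    unfolding sum_distrib_left
  proof (rule sum_mono)
    fix P assume "P \<in> C'"
    then have "P \<in> stopping R" by (simp add: C'_def)
    then have "36 * i * a \<le> between P R" "0 \<le> \<mu> P"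
      using stopping_gt[of P R] \<mu>_pos[of P] st by (auto simp: a_def less_imp_le)
    then show "36 * i * a * \<mu> P \<le> \<mu> P * between P R"
      by (subst mult.commute) (rule mult_left_mono)
  qed
  also have "\<dots> = (\<Sum>P\<in>C'. \<Sum>Q\<in>{Q \<in> SR. P \<subseteq> A Q}. \<mu> P * weight Q)"
    unfolding between_def sum_distrib_left by (intro sum.cong) (auto simp: SR_def)
  also have "\<dots> = (\<Sum>Q\<in>SR. \<Sum>P\<in>{P \<in> C'. P \<subseteq> A Q}. \<mu> P * weight Q)"
    by (rule sum.swap_restrict) (use fin in auto)
  also have "\<dots> = (\<Sum>Q\<in>SR. sum \<mu> {P \<in> C'. P \<subseteq> A Q} * weight Q)"
    by (simp add: sum_distrib_right)
  \<comment> \<open>If \<open>A Q\<close> lies in some \<open>b\<close> of \<open>\<B>\<close>, then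
    every stopping cube inside \<open>A Q\<close> belongs to \<open>C\<close>, so no cube of
    \<open>C'\<close> is counted for this \<open>Q\<close>.\<close>
  also have "\<dots> = (\<Sum>Q\<in>U. sum \<mu> {P \<in> C'. P \<subseteq> A Q} * weight Q)"
  proof (rule sum.mono_neutral_right)
    show "\<forall>Q\<in>SR - U. sum \<mu> {P \<in> C'. P \<subseteq> A Q} * weight Q = 0"
    proof
      fix Q assume "Q \<in> SR - U"
      then have "{P \<in> C'. P \<subseteq> A Q} = {}" unfolding U_def C'_def C_def by blast
      then show "sum \<mu> {P \<in> C'. P \<subseteq> A Q} * weight Q = 0" by (simp only: sum.empty mult_zero_left)
    qed
  qed (use fin in \<open>auto simp: U_def\<close>)
  \<comment> \<open>The disjoint cubes of \<open>C'\<close> inside \<open>A Q\<close> have total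
    measure at most \<open>\<mu> (A Q)\<close>, which cancels the denominator of
    \<open>weight Q\<close>.\<close>
  also have "\<dots> \<le> sum \<nu> U"
  proof (rule sum_mono)
    fix Q assume "Q \<in> U"
    then have Q: "Q \<in> S" by (simp add: U_def SR_def)
    have "sum \<mu> {P \<in> C'. P \<subseteq> A Q} * weight Q \<le> \<mu> (A Q) * weight Q"
      by (intro mult_right_mono packed weight_nonneg A_in Q) (auto simp: C'_def)
    then show "sum \<mu> {P \<in> C'. P \<subseteq> A Q} * weight Q \<le> \<nu> Q"
      using \<mu>_pos[OF A_in[OF Q]] by (simp add: weight_def)
  qed
  \<comment> \<open>A cube of \<open>U\<close> either has mean at most \<open>4 * a\<close> or lies
    in some maximal \<open>b\<close> of large mean; in the second case its ancestor is not contained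
    in \<open>b\<close>, by the choice of \<open>U\<close>.\<close>
  also have "\<dots> \<le> sum \<nu> ({Q \<in> S. Q \<subseteq> R \<and> \<nu> Q \<le> 4 * a * \<mu> Q} \<union> (\<Union>b\<in>\<B>. {Q \<in> S. Q \<subseteq> b \<and> \<not> A Q \<subseteq> b}))"
  proof (rule sum_mono2)
    show "U \<subseteq> {Q \<in> S. Q \<subseteq> R \<and> \<nu> Q \<le> 4 * a * \<mu> Q} \<union> (\<Union>b\<in>\<B>. {Q \<in> S. Q \<subseteq> b \<and> \<not> A Q \<subseteq> b})"
    proof
      fix Q assume Q: "Q \<in> U"
      then have Q': "Q \<in> S" "Q \<subseteq> R" using A_superset by (auto simp: U_def SR_def)
      show "Q \<in> {Q \<in> S. Q \<subseteq> R \<and> \<nu> Q \<le> 4 * a * \<mu> Q} \<union> (\<Union>b\<in>\<B>. {Q \<in> S. Q \<subseteq> b \<and> \<not> A Q \<subseteq> b})"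
      proof (cases "Q \<in> F")
        case True
        then obtain b where "b \<in> \<B>" "Q \<subseteq> b" using ex_maximals_superset[OF F(1)] \<B>_def by metis
        then show ?thesis using Q Q' by (auto simp: U_def)
      qed (use Q' in \<open>auto simp: F_def\<close>)
    qed
  qed (use finite_S B(1) S_subset \<nu>_nonneg in auto)
  also have "\<dots> \<le> sum \<nu> {Q \<in> S. Q \<subseteq> R \<and> \<nu> Q \<le> 4 * a * \<mu> Q}
      + sum \<nu> (\<Union>b\<in>\<B>. {Q \<in> S. Q \<subseteq> b \<and> \<not> A Q \<subseteq> b})"
  proof -
    have subadd: "sum \<nu> (X \<union> Y) \<le> sum \<nu> X + sum \<nu> Y" if "X \<subseteq> S" "Y \<subseteq> S" for X Y
    proof -
      have "0 \<le> sum \<nu> (X \<inter> Y)" using that S_subset \<nu>_nonneg by (intro sum_nonneg) auto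
      moreover have "finite X" "finite Y" using that finite_S by (auto intro: finite_subset)
      ultimately show ?thesis using sum.union_inter[of X Y \<nu>] by simp
    qed
    show ?thesis by (rule subadd) auto
  qed
  also have "sum \<nu> (\<Union>b\<in>\<B>. {Q \<in> S. Q \<subseteq> b \<and> \<not> A Q \<subseteq> b}) \<le> i * \<nu> R"
  proof -
    have "sum \<nu> (\<Union>b\<in>\<B>. {Q \<in> S. Q \<subseteq> b \<and> \<not> A Q \<subseteq> b}) = (\<Sum>b\<in>\<B>. sum \<nu> {Q \<in> S. Q \<subseteq> b \<and> \<not> A Q \<subseteq> b})"
    proof (rule sum.UNION_disjoint)
      show "\<forall>b\<in>\<B>. \<forall>b'\<in>\<B>. b \<noteq> b' \<longrightarrow> {Q \<in> S. Q \<subseteq> b \<and> \<not> A Q \<subseteq> b} \<inter> {Q \<in> S. Q \<subseteq> b' \<and> \<not> A Q \<subseteq> b'} = {}"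
      proof (intro ballI impI equals0I)
        fix b b' P assume *: "b \<in> \<B>" "b' \<in> \<B>" "b \<noteq> b'"
          "P \<in> {Q \<in> S. Q \<subseteq> b \<and> \<not> A Q \<subseteq> b} \<inter> {Q \<in> S. Q \<subseteq> b' \<and> \<not> A Q \<subseteq> b'}"
        then have "P \<noteq> {}" using S_subset nonempty by auto
        moreover have "b \<inter> b' = {}" using B(3) * by (auto simp: pairwise_def disjnt_def)
        ultimately show False using * by blast
      qed
    qed (use B finite_S in auto)
    also have "\<dots> \<le> (\<Sum>b\<in>\<B>. i * \<nu> b)" using B by (intro sum_mono escaping) auto
    also have "\<dots> = i * sum \<nu> \<B>" by (simp add: sum_distrib_left)
    also have "\<dots> \<le> i * \<nu> R" using \<nu>B by (intro mult_left_mono) auto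
    finally show ?thesis .
  qed
  also have "sum \<nu> {Q \<in> S. Q \<subseteq> R \<and> \<nu> Q \<le> 4 * a * \<mu> Q} \<le> 4 * a * sum \<mu> {Q \<in> S. Q \<subseteq> R}"
    unfolding sum_distrib_left
  proof (rule order_trans[OF sum_mono sum_mono2])
    fix Q assume "Q \<in> {Q \<in> S. Q \<subseteq> R} - {Q \<in> S. Q \<subseteq> R \<and> \<nu> Q \<le> 4 * a * \<mu> Q}"
    then show "0 \<le> 4 * a * \<mu> Q" using S_subset a \<mu>_pos[of Q] by auto
  qed (use finite_S in auto)
  also have "\<dots> \<le> 4 * a * (2 * \<mu> R)"
    using carleson[OF R] a by (intro mult_left_mono) auto
  \<comment> \<open>The 8 is the mean bound 4 times the packing constant 2, and \<open>i\<close>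
    comes from the escaping cubes. Since \<open>8 + i \<le> 9 * i\<close>, the threshold factor
    \<open>36 = 4 * 9\<close> leaves a quarter of \<open>R\<close>.\<close>
  finally have "36 * i * a * sum \<mu> C' \<le> (8 + i) * (a * \<mu> R)"
    using aR by (simp add: algebra_simps)
  also have "\<dots> \<le> (9 * i) * (a * \<mu> R)"
    using i_pos a \<mu>_pos[OF R] by (intro mult_right_mono) auto
  finally have "(9 * i * a) * (4 * sum \<mu> C') \<le> (9 * i * a) * \<mu> R" by (simp add: algebra_simps)
  then have C': "sum \<mu> C' \<le> 1 / 4 * \<mu> R" using i_pos a by simp
  have "sum \<mu> (stopping R) = sum \<mu> C' + sum \<mu> C"
    unfolding C'_def using st by (intro sum.subset_diff) (auto simp: C_def)
  then show ?thesis using C C' by simp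
qed

text \<open>A stopping cube equal to \<open>R\<close> would already have more than half the measure
  of \<open>R\<close>. Strictness is what makes the iteration of the stopping rule
  terminate.\<close>

lemma stopping_psubset:
  assumes "R \<in> \<D>" "P \<in> stopping R"
  shows "P \<subset> R"
proof -
  have "P \<noteq> R"
  proof
    assume "P = R"
    moreover have "\<mu> P' \<ge> 0" if "P' \<in> stopping R" for P'
      using that stopping_in_grid \<mu>_pos[of P'] by simp
    ultimately have "\<mu> R \<le> sum \<mu> (stopping R)"
      using assms finite_stopping by (intro member_le_sum) auto
    then show False using sum_stopping_le[OF assms(1)] \<mu>_pos[OF assms(1)] by simp
  qed
  then show ?thesis using stopping_le[OF assms(2)] by blast
qed

section \<open>Pointwise bound for one stopping step\<close>

lemma truncated_nonneg: "truncated R x \<ge> 0"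
  unfolding truncated_def using weight_nonneg by (intro sum_nonneg) auto

text \<open>At a point \<open>x\<close>, the ancestors inside no stopping cube form a chain, whose
  sum is \<open>between Pm R\<close> for its smallest member \<open>Pm\<close>; exceeding the
  threshold would put \<open>Pm\<close> inside a stopping cube. The remaining ancestors all lie in
  the single stopping cube that contains \<open>x\<close>.\<close>

lemma truncated_le:
  assumes R: "R \<in> \<D>"
  shows "truncated R x \<le> 36 * i * (\<nu> R / \<mu> R) * indicator R x + (\<Sum>P\<in>stopping R. truncated P x)"
proof -
  define V where "V = {Q \<in> S. A Q \<subseteq> R \<and> x \<in> A Q}"
  define V1 where "V1 = {Q \<in> V. \<not> (\<exists>P\<in>stopping R. A Q \<subseteq> P)}"
  have finV: "finite V" "finite V1" "V1 \<subseteq> V" using finite_S by (auto simp: V_def V1_def)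
  have pos: "36 * i * (\<nu> R / \<mu> R) \<ge> 0" using \<mu>_pos[OF R] \<nu>_nonneg[OF R] by simp
  have "sum weight V1 \<le> 36 * i * (\<nu> R / \<mu> R) * indicator R x"
  proof (cases "V1 = {}")
    case True
    show ?thesis unfolding True sum.empty by (intro mult_nonneg_nonneg pos) simp
  next
    case False
    \<comment> \<open>All these ancestors contain \<open>x\<close>, so by nestedness a minimal one
      is contained in every other.\<close>
    then obtain Pm where Pm: "Pm \<in> A ` V1" "\<forall>P\<in>A ` V1. P \<subseteq> Pm \<longrightarrow> Pm = P"
      using finite_has_minimal[of "A ` V1"] finV by auto
    have x: "x \<in> Pm" "x \<in> R" "Pm \<subseteq> R" "Pm \<in> A ` S" using Pm(1) by (auto simp: V1_def V_def)
    have Pm_out: "\<not> Pm \<subseteq> P" if "P \<in> stopping R" for P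
      using Pm(1) that by (force simp: V1_def)
    have "V1 = {Q \<in> S. Pm \<subseteq> A Q \<and> A Q \<subseteq> R}"
    proof (intro equalityI subsetI)
      fix Q assume Q: "Q \<in> V1"
      then have *: "x \<in> A Q \<inter> Pm" and "Q \<in> S" "A Q \<subseteq> R" using x by (auto simp: V1_def V_def)
      have "A Q \<inter> Pm \<in> {A Q, Pm, {}}" by (intro nested) (use A_in \<open>Q \<in> S\<close> x in auto)
      with * have "A Q \<subseteq> Pm \<or> Pm \<subseteq> A Q" by blast
      moreover have "Pm = A Q" if "A Q \<subseteq> Pm" using Pm(2)[rule_format, OF imageI[OF Q] that] .
      ultimately have "Pm \<subseteq> A Q" by fast
      with \<open>Q \<in> S\<close> \<open>A Q \<subseteq> R\<close> show "Q \<in> {Q \<in> S. Pm \<subseteq> A Q \<and> A Q \<subseteq> R}"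
        by (intro CollectI conjI)
    next
      fix Q assume Q: "Q \<in> {Q \<in> S. Pm \<subseteq> A Q \<and> A Q \<subseteq> R}"
      then have "Q \<in> S" "Pm \<subseteq> A Q" "A Q \<subseteq> R" by simp_all
      then have "Q \<in> V" "\<not> (\<exists>P\<in>stopping R. A Q \<subseteq> P)"
        using x(1) Pm_out unfolding V_def by (fast, fast)
      then show "Q \<in> V1" unfolding V1_def by simp
    qed
    then have eq: "sum weight V1 = between Pm R" by (simp add: between_def)
    have "between Pm R \<le> 36 * i * (\<nu> R / \<mu> R)"
    proof (rule ccontr)
      assume "\<not> ?thesis"
      then have "Pm \<in> {P \<in> A ` S. P \<subseteq> R \<and> between P R > 36 * i * (\<nu> R / \<mu> R)}" using x by auto
      moreover have "finite {P \<in> A ` S. P \<subseteq> R \<and> between P R > 36 * i * (\<nu> R / \<mu> R)}"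
        using finite_S by simp
      ultimately obtain P where "P \<in> stopping R" "Pm \<subseteq> P"
        unfolding stopping_def using ex_maximals_superset by blast
      then show False using Pm_out by simp
    qed
    then show ?thesis using eq x by simp
  qed
  moreover have "sum weight (V - V1) \<le> (\<Sum>P\<in>stopping R. truncated P x)"
  proof (cases "V - V1 = {}")
    case True
    then show ?thesis using truncated_nonneg by (simp only: sum.empty) (intro sum_nonneg, auto)
  next
    case False
    then obtain P where P: "P \<in> stopping R" "x \<in> P" by (auto simp: V1_def V_def)
    have "V - V1 \<subseteq> {Q \<in> S. A Q \<subseteq> P \<and> x \<in> A Q}"
    proof
      fix Q assume "Q \<in> V - V1"
      then obtain P' where P': "P' \<in> stopping R" "A Q \<subseteq> P'" "Q \<in> S" "x \<in> A Q"
        by (auto simp: V1_def V_def)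
      then have "P = P'" using disjoint_stopping[of R] P by (auto simp: pairwise_def disjnt_def)
      then show "Q \<in> {Q \<in> S. A Q \<subseteq> P \<and> x \<in> A Q}" using P' by simp
    qed
    then have "sum weight (V - V1) \<le> truncated P x"
      unfolding truncated_def by (intro sum_mono2) (use finite_S weight_nonneg in auto)
    also have "\<dots> \<le> (\<Sum>P\<in>stopping R. truncated P x)"
      using P finite_stopping truncated_nonneg by (intro member_le_sum) auto
    finally show ?thesis .
  qed
  moreover have "truncated R x = sum weight (V - V1) + sum weight V1"
    unfolding truncated_def V_def[symmetric] by (intro sum.subset_diff finV)
  ultimately show ?thesis by simp
qed

section \<open>Generations of stopping cubes\<close>

primrec generation :: "nat \<Rightarrow> 'a set set" where
  "generation 0 = maximals (A ` S)"
| "generation (Suc m) = (\<Union>P\<in>generation m. stopping P)"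

lemma generation_subset: "generation m \<subseteq> A ` S"
proof (cases m)
  case 0
  then show ?thesis using maximals_subset by simp
next
  case (Suc k)
  then show ?thesis using stopping_subset by (simp add: UN_subset_iff)
qed

lemma generation_in_grid: "P \<in> generation m \<Longrightarrow> P \<in> \<D>"
  using generation_subset A_image_subset by blast

lemma finite_generation: "finite (generation m)"
  using generation_subset finite_S by (meson finite_imageI finite_subset)

lemma disjoint_generation: "disjoint (generation m)"
proof (induction m)
  case 0
  then show ?case using disjoint_maximals A_image_subset by simp
next
  case (Suc m)
  show ?case
    unfolding pairwise_def
  proof (intro ballI impI)
    fix P P' assume "P \<in> generation (Suc m)" "P' \<in> generation (Suc m)" and ne: "P \<noteq> P'"
    then obtain R R' where R: "R \<in> generation m" "P \<in> stopping R" "R' \<in> generation m" "P' \<in> stopping R'"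
      by auto
    show "disjnt P P'"
    proof (cases "R = R'")
      case True
      then show ?thesis using R ne disjoint_stopping[of R] by (auto simp: pairwise_def)
    next
      case False
      then have "disjnt R R'" using Suc R by (auto simp: pairwise_def)
      then show ?thesis using R stopping_le unfolding disjnt_def by blast
    qed
  qed
qed

lemma Union_generation_Suc: "\<Union>(generation (Suc m)) \<subseteq> \<Union>(generation m)"
proof
  fix x assume "x \<in> \<Union>(generation (Suc m))"
  then obtain R P where "R \<in> generation m" "P \<in> stopping R" "x \<in> P" by auto
  then show "x \<in> \<Union>(generation m)" using stopping_le by blast
qed

text \<open>Stopping cubes of other parents stay inside parents disjoint from \<open>P\<close>. This
  reduces the half-measure condition of sparseness to \<open>sum_stopping_le\<close>.\<close>

lemma generation_Suc_Int:
  assumes "P \<in> generation m"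
  shows "\<Union>(generation (Suc m)) \<inter> P = \<Union>(stopping P)"
proof -
  have "P = P'" if "P' \<in> generation m" "x \<in> P" "x \<in> P'" for P' x
    using disjoint_generation[of m] assms that unfolding pairwise_def disjnt_def by blast
  then show ?thesis using assms stopping_le unfolding generation.simps by blast
qed

text \<open>Each passage from a parent to a stopping cube is strict, so a cube of generation
  \<open>m\<close> has at least \<open>m\<close> strictly larger cubes above it in the finite image
  of \<open>S\<close> under \<open>A\<close>. Hence only finitely many generations are
  nonempty.\<close>

lemma generation_less_card: "P \<in> generation m \<Longrightarrow> m < card {R \<in> A ` S. P \<subseteq> R}"
proof (induction m arbitrary: P)
  case 0
  then have "P \<in> {R \<in> A ` S. P \<subseteq> R}" using generation_subset by blast
  then show ?case using finite_S by (auto simp: card_gt_0_iff)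
next
  case (Suc m)
  then obtain R where R: "R \<in> generation m" "P \<in> stopping R" by auto
  have PR: "P \<subset> R" using stopping_psubset R generation_in_grid by blast
  have "P \<in> A ` S" using Suc generation_subset by blast
  then have "{R' \<in> A ` S. R \<subseteq> R'} \<subset> {R \<in> A ` S. P \<subseteq> R}" using PR by blast
  then have "card {R' \<in> A ` S. R \<subseteq> R'} < card {R \<in> A ` S. P \<subseteq> R}"
    using finite_S by (intro psubset_card_mono) auto
  then show ?case using Suc.IH[OF R(1)] by simp
qed

lemma generation_empty: "generation (card (A ` S)) = {}"
proof -
  have "card {R \<in> A ` S. P \<subseteq> R} \<le> card (A ` S)" for P
    using finite_S by (intro card_mono) auto
  then show ?thesis using generation_less_card by (meson equals0I not_le)
qed

text \<open>This is \<open>truncated_le\<close> applied \<open>N\<close> times; the last sum is the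
  remainder, which vanishes once generation \<open>N\<close> is empty.\<close>

lemma sum_truncated_generation_le:
  "(\<Sum>P\<in>generation 0. truncated P x)
    \<le> 36 * i * (\<Sum>m<N. \<Sum>P\<in>generation m. \<nu> P / \<mu> P * indicator P x) + (\<Sum>P\<in>generation N. truncated P x)"
proof (induction N)
  case (Suc N)
  have "(\<Sum>P\<in>generation N. truncated P x)
    \<le> (\<Sum>P\<in>generation N. 36 * i * (\<nu> P / \<mu> P) * indicator P x + (\<Sum>P'\<in>stopping P. truncated P' x))"
    by (rule sum_mono) (rule truncated_le[OF generation_in_grid])
  also have "\<dots> = 36 * i * (\<Sum>P\<in>generation N. \<nu> P / \<mu> P * indicator P x)
      + (\<Sum>P\<in>generation N. \<Sum>P'\<in>stopping P. truncated P' x)"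
    by (simp add: sum.distrib sum_distrib_left mult.assoc)
  also have "(\<Sum>P\<in>generation N. \<Sum>P'\<in>stopping P. truncated P' x) = (\<Sum>P\<in>generation (Suc N). truncated P x)"
    unfolding generation.simps
  \<comment> \<open>Distinct parents are disjoint and stopping cubes are nonempty, so no stopping
    cube has two parents.\<close>
  proof (rule sum.UNION_disjoint[symmetric])
    show "\<forall>P\<in>generation N. \<forall>P'\<in>generation N. P \<noteq> P' \<longrightarrow> stopping P \<inter> stopping P' = {}"
    proof (intro ballI impI equals0I)
      fix P P' Q assume *: "P \<in> generation N" "P' \<in> generation N" "P \<noteq> P'" "Q \<in> stopping P \<inter> stopping P'"
      then have "Q \<noteq> {}" using nonempty[OF stopping_in_grid] by blast
      moreover have "Q \<subseteq> P \<inter> P'" using * stopping_le by blast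
      moreover have "P \<inter> P' = {}" using * disjoint_generation[of N] by (auto simp: pairwise_def disjnt_def)
      ultimately show False by blast
    qed
  qed (use finite_generation finite_stopping in auto)
  finally show ?case using Suc by (simp add: algebra_simps)
qed simp

text \<open>Every ancestor lies in a maximal one, and maximal ones are disjoint, so at a point
  covered by some ancestor the whole sum is bounded by a single localized sum of generation
  0.\<close>

theorem sum_weight_le:
  "(\<Sum>Q\<in>S. weight Q * indicator (A Q) x)
    \<le> 36 * i * (\<Sum>m<card (A ` S). \<Sum>P\<in>generation m. \<nu> P / \<mu> P * indicator P x)"
proof -
  have "(\<Sum>Q\<in>S. weight Q * indicator (A Q) x) = sum weight {Q \<in> S. x \<in> A Q}"
    unfolding sum.inter_filter[OF finite_S] by (intro sum.cong) (auto simp: indicator_def)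
  also have "\<dots> \<le> (\<Sum>P\<in>generation 0. truncated P x)"
  proof (cases "{Q \<in> S. x \<in> A Q} = {}")
    case True
    then show ?thesis using truncated_nonneg by (simp only: sum.empty) (intro sum_nonneg, auto)
  next
    case False
    have max: "\<exists>P\<in>generation 0. A Q \<subseteq> P" if "Q \<in> S" for Q
      using ex_maximals_superset[of "A ` S" "A Q"] that finite_S by auto
    then obtain P where P: "P \<in> generation 0" "x \<in> P" using False by blast
    have "{Q \<in> S. x \<in> A Q} \<subseteq> {Q \<in> S. A Q \<subseteq> P \<and> x \<in> A Q}"
    proof
      fix Q assume Q: "Q \<in> {Q \<in> S. x \<in> A Q}"
      then obtain P' where P': "P' \<in> generation 0" "A Q \<subseteq> P'" using max by blast
      then have "P = P'" using Q disjoint_generation[of 0] P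
        unfolding pairwise_def disjnt_def by blast
      then show "Q \<in> {Q \<in> S. A Q \<subseteq> P \<and> x \<in> A Q}" using Q P' by simp
    qed
    then have "sum weight {Q \<in> S. x \<in> A Q} \<le> truncated P x"
      unfolding truncated_def by (intro sum_mono2) (use finite_S weight_nonneg in auto)
    also have "\<dots> \<le> (\<Sum>P\<in>generation 0. truncated P x)"
      by (intro member_le_sum P(1) finite_generation truncated_nonneg)
    finally show ?thesis .
  qed
  finally show ?thesis
    using sum_truncated_generation_le[of x "card (A ` S)"] generation_empty by simp
qed

end

section \<open>Measure and side length of cubes\<close>

lemma
  fixes Q :: "(real^'n::finite) set"
  assumes "cube_of_side l Q"
  shows lmeasurable_cube_of_side: "Q \<in> lmeasurable"
    and measure_cube_of_side: "measure lebesgue Q = l ^ CARD('n)"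
    and bounded_cube_of_side: "bounded Q"
    and cube_of_side_nonempty: "Q \<noteq> {}"
proof -
  obtain a :: "real^'n" and I where l: "l > 0"
    and I: "\<And>j. {a $ j <..< a $ j + l} \<subseteq> I j" "\<And>j. I j \<subseteq> {a $ j .. a $ j + l}"
    and Q: "Q = {x. \<forall>j. x $ j \<in> I j}"
    using assms unfolding cube_of_side_def by blast
  define b where "b = a + (\<chi> j. l)"
  have b: "b $ j = a $ j + l" for j by (simp add: b_def)
  have box: "box a b \<subseteq> Q"
    unfolding Q using I(1) by (force simp: mem_box_cart b)
  have cbox: "Q \<subseteq> cbox a b"
    unfolding Q using I(2) by (fastforce simp: mem_box_cart b)
  \<comment> \<open>Whichever endpoints the intervals contain, \<open>Q\<close> lies between the
    open and the closed box, so it differs from \<open>cbox a b\<close> only on the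
    frontier.\<close>
  have neg: "negligible ((cbox a b - Q) \<union> (Q - cbox a b))"
    by (rule negligible_subset[OF negligible_frontier_interval[of a b]]) (use box cbox in auto)
  have mid: "a + (\<chi> j. l / 2) \<in> box a b" using l by (simp add: mem_box_cart b)
  then have "cbox a b \<noteq> {}" using box_subset_cbox by blast
  then have "measure lebesgue (cbox a b) = l ^ CARD('n)"
    by (simp add: content_cbox_cart b)
  then show "measure lebesgue Q = l ^ CARD('n)"
    using measure_negligible_symdiff[OF _ neg] by simp
  show "Q \<in> lmeasurable" using lmeasurable_negligible_symdiff[OF _ neg] by simp
  show "bounded Q" using cbox bounded_cbox bounded_subset by blast
  show "Q \<noteq> {}" using mid box by blast
qed

text \<open>The measure \<open>l ^ CARD('n)\<close> determines \<open>l\<close>, so the definite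
  description in \<open>side_length\<close> is well defined.\<close>

lemma side_length_eq:
  assumes "cube_of_side l (Q :: (real^'n::finite) set)"
  shows "side_length Q = l"
  unfolding side_length_def
proof (rule the_equality)
  fix l' assume l': "cube_of_side l' Q"
  then have "l' ^ CARD('n) = l ^ CARD('n)"
    using measure_cube_of_side[OF l'] measure_cube_of_side[OF assms] by simp
  moreover have "0 < l" "0 < l'" using assms l' by (auto simp: cube_of_side_def)
  ultimately show "l' = l" by (metis power_eq_imp_eq_base less_imp_le zero_less_card_finite)
qed (rule assms)

section \<open>Dyadic grids and ancestors\<close>

locale grid =
  fixes \<D> :: "(real^'n::finite) set set"
  assumes grid: "dyadic_grid \<D>"
begin

lemma cube_of_side_length: "Q \<in> \<D> \<Longrightarrow> cube_of_side (side_length Q) Q"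
  using grid side_length_eq unfolding dyadic_grid_def cube_def by metis

lemmas lmeasurable = lmeasurable_cube_of_side[OF cube_of_side_length]
  and measure_eq = measure_cube_of_side[OF cube_of_side_length]
  and bounded = bounded_cube_of_side[OF cube_of_side_length]
  and nonempty = cube_of_side_nonempty[OF cube_of_side_length]

lemma side_length_pos: "Q \<in> \<D> \<Longrightarrow> side_length Q > 0"
  using cube_of_side_length by (auto simp: cube_of_side_def)

lemma measure_pos: "Q \<in> \<D> \<Longrightarrow> measure lebesgue Q > 0"
  by (simp add: measure_eq side_length_pos)

lemma side_length_powi: "Q \<in> \<D> \<Longrightarrow> \<exists>k::int. side_length Q = 2 powi k"
  using grid unfolding dyadic_grid_def by blast

lemma Int_cases: "Q \<in> \<D> \<Longrightarrow> R \<in> \<D> \<Longrightarrow> Q \<inter> R \<in> {Q, R, {}}"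
  using grid unfolding dyadic_grid_def by blast

lemma partition: "partition_on UNIV {Q \<in> \<D>. side_length Q = 2 powi (k::int)}"
  using grid unfolding dyadic_grid_def by blast

lemma same_side_disjnt:
  assumes "Q \<in> \<D>" "R \<in> \<D>" "side_length Q = side_length R" "Q \<noteq> R"
  shows "disjnt Q R"
proof -
  obtain k :: int where "side_length Q = 2 powi k" using side_length_powi assms by blast
  then show ?thesis
    using partition_onD2[OF partition[of k]] assms by (auto simp: pairwise_def)
qed

lemma side_length_mono:
  assumes "Q \<in> \<D>" "R \<in> \<D>" "Q \<subseteq> R"
  shows "side_length Q \<le> side_length R"
proof -
  have "side_length Q ^ CARD('n) \<le> side_length R ^ CARD('n)"
    using assms measure_mono_fmeasurable[of Q R lebesgue] lmeasurable fmeasurableD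
    by (simp flip: measure_eq)
  then show ?thesis
    using assms side_length_pos by (meson power_mono_iff zero_less_card_finite less_imp_le)
qed

lemma subset_if_side_length_le:
  assumes "Q \<in> \<D>" "R \<in> \<D>" "side_length Q \<le> side_length R" "x \<in> Q" "x \<in> R"
  shows "Q \<subseteq> R"
proof (rule ccontr)
  assume "\<not> Q \<subseteq> R"
  then have "R \<subseteq> Q" using Int_cases[of Q R] assms by blast
  then have "side_length Q = side_length R" using side_length_mono[of R Q] assms by simp
  then have "disjnt Q R" using same_side_disjnt assms \<open>\<not> Q \<subseteq> R\<close> by blast
  then show False using assms by (auto simp: disjnt_def)
qed

text \<open>Existence: the partition into cubes of side \<open>2 ^ i * side_length Q\<close> has a
  member through a point of \<open>Q\<close>, and comparing sizes shows that it contains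
  \<open>Q\<close>. Uniqueness: distinct cubes of equal size are disjoint.\<close>

lemma
  assumes Q: "Q \<in> \<D>"
  shows ancestor_in: "ancestor \<D> i Q \<in> \<D>"
    and ancestor_superset: "Q \<subseteq> ancestor \<D> i Q"
    and side_length_ancestor: "side_length (ancestor \<D> i Q) = 2 ^ i * side_length Q"
proof -
  obtain k :: int where k: "side_length Q = 2 powi k" using side_length_powi[OF Q] by blast
  have side: "2 ^ i * side_length Q = 2 powi (int i + k)" by (simp add: k power_int_add)
  obtain x where x: "x \<in> Q" using nonempty[OF Q] by blast
  obtain R where R: "R \<in> \<D>" "side_length R = 2 ^ i * side_length Q" "x \<in> R"
    using partition_onD1[OF partition[of "int i + k"]] side by auto
  have "side_length Q \<le> side_length R"
    unfolding R(2) using side_length_pos[OF Q] by simp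
  then have "Q \<subseteq> R" using subset_if_side_length_le Q R x by blast
  then have "R \<in> \<D> \<and> Q \<subseteq> R \<and> side_length R = 2 ^ i * side_length Q" using R by simp
  moreover have "R' = R" if "R' \<in> \<D> \<and> Q \<subseteq> R' \<and> side_length R' = 2 ^ i * side_length Q" for R'
    using same_side_disjnt[of R' R] that R x by (auto simp: disjnt_def)
  ultimately have "ancestor \<D> i Q \<in> \<D> \<and> Q \<subseteq> ancestor \<D> i Q
      \<and> side_length (ancestor \<D> i Q) = 2 ^ i * side_length Q"
    unfolding ancestor_def by (rule theI)
  then show "ancestor \<D> i Q \<in> \<D>" "Q \<subseteq> ancestor \<D> i Q"
    "side_length (ancestor \<D> i Q) = 2 ^ i * side_length Q" by simp_all
qed

lemma measure_ancestor:
  "Q \<in> \<D> \<Longrightarrow> measure lebesgue (ancestor \<D> i Q) = 2 ^ (i * CARD('n)) * measure lebesgue Q"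
  by (simp add: measure_eq ancestor_in side_length_ancestor power_mult_distrib power_mult)

lemma sum_measure_le:
  assumes "finite F" "F \<subseteq> \<D>" "disjoint F" "R \<in> \<D>" "\<Union>F \<subseteq> R"
  shows "sum (measure lebesgue) F \<le> measure lebesgue R"
proof -
  have F: "Q \<in> lmeasurable" if "Q \<in> F" for Q using that assms lmeasurable by blast
  have "sum (measure lebesgue) F = measure lebesgue (\<Union>F)"
    using assms F by (intro measure_Union'[symmetric]) (auto simp: pairwise_def)
  also have "\<dots> \<le> measure lebesgue R"
    using assms F lmeasurable by (intro measure_mono_fmeasurable) (auto intro!: sets.finite_Union fmeasurableD)
  finally show ?thesis .
qed

lemma set_integrable_cube:
  assumes "locally_integrable f" "Q \<in> \<D>"
  shows "set_integrable lebesgue Q f"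
proof -
  have "compact (closure Q)" using bounded[OF assms(2)] by simp
  then have "set_integrable lebesgue (closure Q) f"
    using assms(1) unfolding locally_integrable_def by blast
  then show ?thesis
    by (rule set_integrable_subset) (use lmeasurable[OF assms(2)] closure_subset in auto)
qed

lemma sum_set_integral_le:
  assumes f: "locally_integrable f" "\<And>x. f x \<ge> 0"
    and F: "finite F" "F \<subseteq> \<D>" "disjoint F" "R \<in> \<D>" "\<Union>F \<subseteq> R"
  shows "(\<Sum>Q\<in>F. LINT y:Q|lebesgue. f y) \<le> (LINT y:R|lebesgue. f y)"
proof -
  have int: "integrable lebesgue (\<lambda>y. indicator Q y *\<^sub>R f y)" if "Q \<in> \<D>" for Q
    using set_integrable_cube[OF f(1) that] by (simp add: set_integrable_def)
  have "(\<Sum>Q\<in>F. LINT y:Q|lebesgue. f y) = (LINT y|lebesgue. (\<Sum>Q\<in>F. indicator Q y *\<^sub>R f y))"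
    unfolding set_lebesgue_integral_def
    by (rule Bochner_Integration.integral_sum[symmetric]) (use int F in blast)
  also have "\<dots> \<le> (LINT y:R|lebesgue. f y)"
    unfolding set_lebesgue_integral_def
  proof (rule integral_mono)
    show "integrable lebesgue (\<lambda>y. \<Sum>Q\<in>F. indicator Q y *\<^sub>R f y)"
      by (rule Bochner_Integration.integrable_sum) (use int F in blast)
    show "integrable lebesgue (\<lambda>y. indicator R y *\<^sub>R f y)" by (rule int[OF F(4)])
    fix y
    have "(\<Sum>Q\<in>F. indicator Q y) = (indicator (\<Union>F) y :: real)"
      using F by (intro indicator_UN_disjoint[of F "\<lambda>x. x", simplified, symmetric])
        (auto simp: disjoint_family_on_def pairwise_def disjnt_def)
    also have "\<dots> \<le> indicator R y" using F(5) by (auto split: split_indicator)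
    finally show "(\<Sum>Q\<in>F. indicator Q y *\<^sub>R f y) \<le> indicator R y *\<^sub>R f y"
      using f(2)[of y] by (simp add: mult_right_mono flip: sum_distrib_right)
  qed
  finally show ?thesis .
qed

text \<open>
  If \<open>Q \<subseteq> B\<close> but \<open>Q\<^sup>(\<^sup>i\<^sup>)\<close> is not contained in \<open>B\<close>, then \<open>\<ell>\<^sub>Q = 2\<^sup>-\<^sup>j \<ell>\<^sub>B\<close> with \<open>0 \<le> j < i\<close>, and the
  cubes \<open>Q \<subseteq> B\<close> of one size are disjoint.
\<close>
lemma sum_set_integral_escaping_le:
  assumes f: "locally_integrable f" "\<And>x. f x \<ge> 0"
    and S: "finite S" "S \<subseteq> \<D>" and B: "B \<in> \<D>"
  shows "(\<Sum>Q\<in>{Q \<in> S. Q \<subseteq> B \<and> \<not> ancestor \<D> i Q \<subseteq> B}. LINT y:Q|lebesgue. f y)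
    \<le> real i * (LINT y:B|lebesgue. f y)"
proof -
  let ?\<nu> = "\<lambda>Q. LINT y:Q|lebesgue. f y"
  define E where "E j = {Q \<in> S. Q \<subseteq> B \<and> side_length B = 2 ^ j * side_length Q}" for j
  have pos: "?\<nu> Q \<ge> 0" for Q
    unfolding set_lebesgue_integral_def using f(2) by (intro integral_nonneg_AE) auto
  have fin: "finite (E j)" for j using S by (simp add: E_def)
  have sub: "{Q \<in> S. Q \<subseteq> B \<and> \<not> ancestor \<D> i Q \<subseteq> B} \<subseteq> (\<Union>j<i. E j)"
  proof
    fix Q assume Q: "Q \<in> {Q \<in> S. Q \<subseteq> B \<and> \<not> ancestor \<D> i Q \<subseteq> B}"
    then have QD: "Q \<in> \<D>" "Q \<subseteq> B" using S by auto
    obtain x where x: "x \<in> Q" using nonempty[OF QD(1)] by blast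
    obtain q b :: int where qb: "side_length Q = 2 powi q" "side_length B = 2 powi b"
      using side_length_powi QD(1) B by metis
    have "x \<in> ancestor \<D> i Q" "x \<in> B" using ancestor_superset[OF QD(1)] x QD(2) by blast+
    then have "side_length B < side_length (ancestor \<D> i Q)"
      using subset_if_side_length_le[OF ancestor_in[OF QD(1)] B] Q by force
    then have "2 powi b < (2::real) powi (int i + q)"
      using qb side_length_ancestor[OF QD(1)] by (simp add: power_int_add)
    then have "b < int i + q" using power_int_increasing[of "int i + q" b "2::real"] by force
    moreover have "q \<le> b"
      using side_length_mono[OF QD(1) B QD(2)] power_int_strict_increasing[of b q "2::real"]
      unfolding qb by force
    \<comment> \<open>The exponent \<open>j\<close> is \<open>nat (b - q)\<close>; since
      \<open>q \<le> b\<close>, the conversion to a natural number does not truncate.\<close>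
    ultimately have "nat (b - q) < i" and "b = int (nat (b - q)) + q" by auto
    moreover from this(2) have "side_length B = 2 ^ nat (b - q) * side_length Q"
      unfolding qb by (metis power_int_add power_int_of_nat zero_neq_numeral)
    ultimately show "Q \<in> (\<Union>j<i. E j)" using Q unfolding E_def by blast
  qed
  have "sum ?\<nu> {Q \<in> S. Q \<subseteq> B \<and> \<not> ancestor \<D> i Q \<subseteq> B} \<le> sum ?\<nu> (\<Union>j<i. E j)"
    using fin pos sub by (intro sum_mono2) auto
  also have "\<dots> = (\<Sum>j<i. sum ?\<nu> (E j))"
  proof (rule sum.UNION_disjoint)
    show "\<forall>j\<in>{..<i}. \<forall>k\<in>{..<i}. j \<noteq> k \<longrightarrow> E j \<inter> E k = {}"
      using S side_length_pos by (fastforce simp: E_def)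
  qed (use fin in auto)
  also have "\<dots> \<le> (\<Sum>j<i. ?\<nu> B)"
  proof (intro sum_mono sum_set_integral_le f fin B)
    fix j
    show "disjoint (E j)"
      unfolding pairwise_def
    proof (intro ballI impI)
      fix Q R assume QR: "Q \<in> E j" "R \<in> E j" "Q \<noteq> R"
      then have "2 ^ j * side_length Q = 2 ^ j * side_length R" by (simp add: E_def)
      then show "disjnt Q R" using same_side_disjnt QR S by (auto simp: E_def)
    qed
  qed (use S in \<open>auto simp: E_def\<close>)
  finally show ?thesis by simp
qed

section \<open>Packing in sparse families\<close>

lemma sparse_subset_level_union:
  assumes S: "sparse_family \<D> S" and s: "(k, Q) \<in> S" "(m, R) \<in> S" "k < m"
  shows "R \<subseteq> level_union S (k + 1)"
proof -
  from S[unfolded sparse_family_def] obtain K where K: "\<forall>a\<in>K. \<forall>b\<in>K. {a..b} \<subseteq> K" "S \<subseteq> K \<times> \<D>"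
    and decr: "\<forall>k. k \<in> K \<and> k + 1 \<in> K \<longrightarrow> level_union S (k + 1) \<subseteq> level_union S k"
    by (elim exE conjE) (rule that)
  have "k \<in> K" "m \<in> K" using K(2) s by auto
  then have km: "{k..m} \<subseteq> K" using K(1) by simp
  have "j \<le> m \<longrightarrow> level_union S j \<subseteq> level_union S (k + 1)" if "k + 1 \<le> j" for j
    using that
  proof (induction j rule: int_ge_induct)
    case (step j)
    show ?case
    proof
      assume "j + 1 \<le> m"
      then have "j \<in> K" "j + 1 \<in> K" using step(1) km by auto
      then have "level_union S (j + 1) \<subseteq> level_union S j" using decr by simp
      then show "level_union S (j + 1) \<subseteq> level_union S (k + 1)" using step \<open>j + 1 \<le> m\<close> by simp
    qed
  qed simp
  then have "level_union S m \<subseteq> level_union S (k + 1)" using s by simp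
  then show ?thesis using s unfolding level_union_def by blast
qed

text \<open>The sets \<open>E (k, Q)\<close>, a cube minus the union of the next level, are pairwise
  disjoint and carry at least half the measure of their cubes, which gives the packing bound.
  Injectivity of \<open>snd\<close> lets sums over indexed cubes be rewritten as sums over plain
  cubes.\<close>

lemma
  assumes S: "sparse_family \<D> S" "finite S"
  shows inj_on_snd_sparse: "inj_on snd S"
    and sparse_carleson: "R \<in> \<D> \<Longrightarrow>
      sum (measure lebesgue) {Q \<in> snd ` S. Q \<subseteq> R} \<le> 2 * measure lebesgue R"
proof -
  define E where "E = (\<lambda>(k, Q). Q - level_union S (k + 1))"
  have D: "Q \<in> \<D>" if "(k, Q) \<in> S" for k Q
    using S(1) that unfolding sparse_family_def by blast
  have disj: "disjoint (S `` {k})" if "(k, Q) \<in> S" for k Q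
    using S(1) that unfolding sparse_family_def by blast
  have level: "level_union S k \<in> lmeasurable" for k
    unfolding level_union_def
    by (rule fmeasurable.finite_Union) (use S(2) D lmeasurable in \<open>auto intro: finite_Image\<close>)
  have E: "E s \<in> lmeasurable" "measure lebesgue (snd s) \<le> 2 * measure lebesgue (E s)" "E s \<subseteq> snd s"
    if s: "s \<in> S" for s
  proof -
    obtain k Q where kQ: "s = (k, Q)" by fastforce
    have Q: "Q \<in> lmeasurable" using D lmeasurable s kQ by blast
    show "E s \<in> lmeasurable" "E s \<subseteq> snd s" using Q level by (auto simp: E_def kQ)
    have "measure lebesgue (level_union S (k + 1) \<inter> Q) \<le> 1 / 2 * measure lebesgue Q"
      using S(1) s kQ unfolding sparse_family_def by blast
    moreover have "measure lebesgue (E s) = measure lebesgue Q - measure lebesgue (level_union S (k + 1) \<inter> Q)"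
    proof -
      have "E s = Q - level_union S (k + 1) \<inter> Q" by (auto simp: E_def kQ)
      then show ?thesis using Q level by (simp add: measurable_measure_Diff fmeasurable_Int_fmeasurable fmeasurableD)
    qed
    ultimately show "measure lebesgue (snd s) \<le> 2 * measure lebesgue (E s)" by (simp add: kQ)
  qed
  have E_disj: "disjnt (E s) (E t)" if st: "s \<in> S" "t \<in> S" "s \<noteq> t" for s t
  proof -
    have less: "disjnt (E (k, Q)) (E (m, R))" if "(k, Q) \<in> S" "(m, R) \<in> S" "k < m" for k Q m R
      using sparse_subset_level_union[OF S(1) that] by (auto simp: E_def disjnt_def)
    obtain k Q m R where kQ: "s = (k, Q)" "t = (m, R)" by fastforce
    consider "k < m" | "m < k" | "k = m" by linarith
    then show ?thesis
    proof cases
      case 3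
      then have "disjnt Q R" using disj[of k Q] st kQ by (auto simp: pairwise_def)
      then show ?thesis by (auto simp: kQ E_def disjnt_def)
    qed (use less st kQ disjnt_sym in blast)+
  qed
  show inj: "inj_on snd S"
  proof (rule inj_onI, rule ccontr)
    fix s t assume st: "s \<in> S" "t \<in> S" "snd s = snd t" "s \<noteq> t"
    have D': "snd s \<in> \<D>" using D st by (metis prod.collapse)
    obtain k m Q where kQ: "s = (k, Q)" "t = (m, Q)" using st(3) by (metis prod.collapse)
    have km: "k \<noteq> m" using st kQ by auto
    \<comment> \<open>If a cube occurred at two levels, its copy at the smaller level would be
      covered by the union of the next level, although \<open>E\<close> must retain half of its
      positive measure.\<close>
    have empty: "E (k, Q) = {}" if "(k, Q) \<in> S" "(m, Q) \<in> S" "k < m" for k m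
      using sparse_subset_level_union[OF S(1) that] by (auto simp: E_def)
    have "E s = {} \<or> E t = {}" using km empty st kQ by (metis linorder_neqE)
    then show False using E(2)[OF st(1)] E(2)[OF st(2)] measure_pos[OF D'] st(3) by auto
  qed
  assume R: "R \<in> \<D>"
  define SR where "SR = {s \<in> S. snd s \<subseteq> R}"
  have SR: "finite SR" "SR \<subseteq> S" using S by (auto simp: SR_def)
  have "{Q \<in> snd ` S. Q \<subseteq> R} = snd ` SR" by (auto simp: SR_def)
  then have "sum (measure lebesgue) {Q \<in> snd ` S. Q \<subseteq> R} = (\<Sum>s\<in>SR. measure lebesgue (snd s))"
    using inj SR by (simp add: sum.reindex inj_on_subset)
  also have "\<dots> \<le> (\<Sum>s\<in>SR. 2 * measure lebesgue (E s))"
    using E SR by (intro sum_mono) auto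
  also have "\<dots> = 2 * measure lebesgue (\<Union>s\<in>SR. E s)"
  proof (subst measure_UNION')
    show "pairwise (\<lambda>s t. disjnt (E s) (E t)) SR"
      unfolding pairwise_def using E_disj SR(2) by blast
  qed (use E(1) SR in \<open>auto simp: sum_distrib_left\<close>)
  also have "\<dots> \<le> 2 * measure lebesgue R"
  proof (intro mult_left_mono measure_mono_fmeasurable lmeasurable R)
    show "(\<Union>s\<in>SR. E s) \<subseteq> R" using E(3) SR by (fastforce simp: SR_def)
    show "(\<Union>s\<in>SR. E s) \<in> sets lebesgue"
      using E(1) SR by (intro sets.finite_UN) auto
  qed simp
  finally show "sum (measure lebesgue) {Q \<in> snd ` S. Q \<subseteq> R} \<le> 2 * measure lebesgue R" .
qed

lemma nested_packing_sparse:
  assumes "sparse_family \<D> S" "finite S" "i \<ge> 1" "locally_integrable f" "\<And>x. f x \<ge> 0"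
  shows "nested_packing \<D> (snd ` S) (ancestor \<D> i) (measure lebesgue) (\<lambda>Q. LINT y:Q|lebesgue. f y) i"
proof
  show sub: "snd ` S \<subseteq> \<D>" using assms(1) unfolding sparse_family_def by fastforce
  show "0 \<le> (LINT y:Q|lebesgue. f y)" for Q
    unfolding set_lebesgue_integral_def using assms(5) by (intro integral_nonneg_AE) auto
  show "ancestor \<D> i Q \<in> \<D>" "Q \<subseteq> ancestor \<D> i Q" if "Q \<in> snd ` S" for Q
    using that sub ancestor_in ancestor_superset by blast+
  show "Q \<inter> R \<in> {Q, R, {}}" if "Q \<in> \<D>" "R \<in> \<D>" for Q R
    using that by (rule Int_cases)
  show "sum (measure lebesgue) {Q \<in> snd ` S. Q \<subseteq> R} \<le> 2 * measure lebesgue R" if "R \<in> \<D>" for R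
    by (rule sparse_carleson[OF assms(1,2) that])
  show "(\<Sum>Q\<in>{Q \<in> snd ` S. Q \<subseteq> B \<and> \<not> ancestor \<D> i Q \<subseteq> B}. LINT y:Q|lebesgue. f y)
      \<le> real i * (LINT y:B|lebesgue. f y)" if "B \<in> \<D>" for B
    by (rule sum_set_integral_escaping_le) (use assms sub that in auto)
qed (use assms in \<open>simp_all add: nonempty measure_pos sum_measure_le sum_set_integral_le\<close>)

end

section \<open>Construction of the dominating sparse family\<close>

theorem mainTheorem7:
  "\<exists>c::real. c > 0 \<and>
     (\<forall>(\<D> :: (real^'n) set set) (S1 :: 'n::finite cube_family) (i::nat) (f :: real^'n \<Rightarrow> real).
        dyadic_grid \<D> \<and> sparse_family \<D> S1 \<and> finite S1 \<and> i \<ge> 1 \<and>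
        locally_integrable f \<and> (\<forall>x. f x \<ge> 0) \<longrightarrow>
        (\<exists>S2 :: 'n cube_family. sparse_family \<D> S2 \<and>
           (AE x in lebesgue.
              sparse_op_star \<D> S1 i f x
                \<le> ennreal (c * real i) * (maximal_function f x + sparse_op S2 f x))))"
proof (intro exI[of _ "36 :: real"] conjI allI impI, goal_cases)
  \<comment> \<open>The constant 36 is the one in the stopping threshold, so it does not even depend
    on the dimension.\<close>
  case (2 \<D> S1 i f)
  then have S1: "sparse_family \<D> S1" "finite S1" and i: "i \<ge> 1"
    and f: "locally_integrable f" "\<And>x. f x \<ge> 0" by auto
  interpret grid \<D> by standard (use 2 in simp)
  interpret nested_packing \<D> "snd ` S1" "ancestor \<D> i" "measure lebesgue" "\<lambda>Q. LINT y:Q|lebesgue. f y" i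
    by (rule nested_packing_sparse[OF S1 i f])
  \<comment> \<open>Generation \<open>m\<close> becomes level \<open>m\<close>, with levels running
    over all nonnegative integers; from some level on there are no cubes.\<close>
  define S2 :: "'n cube_family" where "S2 = {(int m, P) | m P. P \<in> generation m}"
  have S2_Image: "S2 `` {k} = (if k \<ge> 0 then generation (nat k) else {})" for k
    by (force simp: S2_def)
  have level: "level_union S2 k = (if k \<ge> 0 then \<Union>(generation (nat k)) else {})" for k
    by (simp add: level_union_def S2_Image)
  have sparse: "sparse_family \<D> S2"
    unfolding sparse_family_def
  proof (intro exI[of _ "{0..}"] conjI ballI allI impI)
    show "S2 \<subseteq> {0..} \<times> \<D>" using generation_in_grid by (auto simp: S2_def)
    show "disjoint (S2 `` {k})" for k using disjoint_generation by (simp add: S2_Image)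
    show "level_union S2 (k + 1) \<subseteq> level_union S2 k" if "k \<in> {0..} \<and> k + 1 \<in> {0..}" for k
      using that Union_generation_Suc[of "nat k"] unfolding level
      by (simp add: nat_add_distrib del: generation.simps)
    show "case s of (k, Q) \<Rightarrow> measure lebesgue (level_union S2 (k + 1) \<inter> Q) \<le> 1 / 2 * measure lebesgue Q"
      if s: "s \<in> S2" for s
    proof -
      obtain m P where P: "s = (int m, P)" "P \<in> generation m" using s by (auto simp: S2_def)
      have "level_union S2 (int m + 1) \<inter> P = \<Union>(stopping P)"
        using generation_Suc_Int[OF P(2)] unfolding level
        by (simp add: nat_add_distrib del: generation.simps)
      then have "measure lebesgue (level_union S2 (int m + 1) \<inter> P) \<le> sum (measure lebesgue) (stopping P)"
        using measure_Union_le[OF finite_stopping, of P lebesgue] lmeasurable[OF stopping_in_grid]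
        by (simp add: fmeasurableD)
      also have "\<dots> \<le> 1 / 2 * measure lebesgue P"
        using P generation_in_grid by (intro sum_stopping_le)
      finally show ?thesis by (simp add: P)
    qed
  qed auto
  have mean_nonneg: "mean f Q \<ge> 0" if "Q \<in> \<D>" for Q
    using \<nu>_nonneg[OF that] by (simp add: mean_def)
  \<comment> \<open>The measure of the ancestor is \<open>2 ^ (i * CARD('n))\<close> times that of
    \<open>Q\<close>, which absorbs the normalizing factor of \<open>sparse_op_star\<close>.\<close>
  have weight_eq: "1 / 2 ^ (i * CARD('n)) * mean f Q = weight Q" if "Q \<in> snd ` S1" for Q
    using measure_ancestor[of Q i] that S_subset by (auto simp: weight_def mean_def)
  have "sparse_op_star \<D> S1 i f x \<le> ennreal (36 * real i) * (maximal_function f x + sparse_op S2 f x)" for x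
  proof -
    let ?N = "card (ancestor \<D> i ` snd ` S1)"
    let ?g = "\<lambda>s. ennreal (mean f (snd s)) * indicator (snd s) x"
    have "sparse_op_star \<D> S1 i f x
        = ennreal (1 / 2 ^ (i * CARD('n))) * (\<Sum>s\<in>S1. ennreal (mean f (snd s)) * indicator (ancestor \<D> i (snd s)) x)"
      unfolding sparse_op_star_def using S1(2) by (simp add: case_prod_unfold)
    also have "\<dots> = (\<Sum>s\<in>S1. ennreal (weight (snd s) * indicator (ancestor \<D> i (snd s)) x))"
      unfolding sum_distrib_left
    proof (rule sum.cong)
      fix s assume "s \<in> S1"
      then show "ennreal (1 / 2 ^ (i * CARD('n))) * (ennreal (mean f (snd s)) * indicator (ancestor \<D> i (snd s)) x)
          = ennreal (weight (snd s) * indicator (ancestor \<D> i (snd s)) x)"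
        by (simp add: weight_eq[symmetric] flip: ennreal_mult' split: split_indicator)
    qed simp
    also have "\<dots> = (\<Sum>Q\<in>snd ` S1. ennreal (weight Q * indicator (ancestor \<D> i Q) x))"
      by (simp add: sum.reindex[OF inj_on_snd_sparse[OF S1]])
    also have "\<dots> = ennreal (\<Sum>Q\<in>snd ` S1. weight Q * indicator (ancestor \<D> i Q) x)"
      using weight_nonneg by (intro sum_ennreal) simp
    also have "\<dots> \<le> ennreal (36 * i * (\<Sum>m<?N. \<Sum>P\<in>generation m. mean f P * indicator P x))"
      using sum_weight_le[of x] by (intro ennreal_leI) (simp add: mean_def)
    also have "\<dots> = ennreal (36 * real i) * ennreal (\<Sum>m<?N. \<Sum>P\<in>generation m. mean f P * indicator P x)"
      by (simp add: ennreal_mult')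
    also have "\<dots> = ennreal (36 * real i) * (\<Sum>m<?N. \<Sum>P\<in>generation m. ennreal (mean f P) * indicator P x)"
    proof -
      \<comment> \<open>Means over grid cubes are nonnegative, so \<open>ennreal\<close> commutes
        with these sums.\<close>
      have "(\<Sum>m<?N. \<Sum>P\<in>generation m. ennreal (mean f P) * indicator P x)
          = (\<Sum>m<?N. \<Sum>P\<in>generation m. ennreal (mean f P * indicator P x))"
        by (intro sum.cong) (auto split: split_indicator)
      also have "\<dots> = (\<Sum>m<?N. ennreal (\<Sum>P\<in>generation m. mean f P * indicator P x))"
        using mean_nonneg generation_in_grid by (intro sum.cong sum_ennreal) simp_all
      also have "\<dots> = ennreal (\<Sum>m<?N. \<Sum>P\<in>generation m. mean f P * indicator P x)"
        using mean_nonneg generation_in_grid by (intro sum_ennreal sum_nonneg) simp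
      finally show ?thesis by simp
    qed
    also have "(\<Sum>m<?N. \<Sum>P\<in>generation m. ennreal (mean f P) * indicator P x) = sum ?g (map_prod int id ` (SIGMA m:{..<?N}. generation m))"
    proof -
      have inj: "inj_on (map_prod int id) (SIGMA m:{..<?N}. generation m)" by (auto simp: inj_on_def)
      have "(\<Sum>m<?N. \<Sum>P\<in>generation m. ennreal (mean f P) * indicator P x)
          = (\<Sum>(m, P)\<in>(SIGMA m:{..<?N}. generation m). ennreal (mean f P) * indicator P x)"
        by (rule sum.Sigma) (simp_all add: finite_generation del: generation.simps)
      also have "\<dots> = sum ?g (map_prod int id ` (SIGMA m:{..<?N}. generation m))"
        unfolding sum.reindex[OF inj] by (intro sum.cong) auto
      finally show ?thesis .
    qed
    also have "\<dots> = infsum ?g (map_prod int id ` (SIGMA m:{..<?N}. generation m))"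
      by (rule infsum_finite[symmetric]) (auto intro: finite_generation)
    \<comment> \<open>The terms are nonnegative, so enlarging the index set to all of
      \<open>S2\<close> cannot decrease the sum.\<close>
    also have "\<dots> \<le> infsum ?g S2"
      by (rule infsum_mono_neutral[OF nonneg_summable_on_complete nonneg_summable_on_complete])
        (auto simp: S2_def)
    also have "\<dots> = sparse_op S2 f x"
      by (simp add: sparse_op_def case_prod_unfold)
    also have "\<dots> \<le> maximal_function f x + sparse_op S2 f x"
      by simp
    finally show ?thesis by (simp add: mult_left_mono)
  qed
  then show ?case using sparse by blast
qed simp

end
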